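(* Let $A\in\mathbb{R}^{d\times d}$ be symmetric, let $b\in\mathbb{R}^d$ be nonzero, let $g$ be the grade of $b$ with respect to $A$, and run MINRES on $(A,b)$ with $x_0=0$. Let $m(x)=\frac12 x^TAx-b^Tx$ and write $\|x\|_A=x^TAx$. Let $1\le k<g$ and suppose the NPC condition has not been detected through iteration $k$, i.e. $c_{i-1}\gamma_i^{(1)}<0$ for all $1\le i\le k$. Then the following hold. (a) If $Ax^\star=b$ for some $x^\star\in\mathbb{R}^d$ (i.e. $b\in\mathrm{Range}(A)$), then $\|x^\star-x_k\|_A$ decreases strictly monotonically with $k$, i.e. $\|x^\star-x_k\|_A<\|x^\star-x_{k-1}\|_A$. (b) If $Ax^\star=b$ for some $x^\star\in\mathbb{R}^d$, then $\omega\mapsto\|x^\star-(x_{k-1}+\omega\tau_k\mathbf{d}_k)\|_A$ is strictly decreasing on $(-\infty,1]$. (c) $m(x_k)$ decreases strictly monotonically with $k$, i.e. $m(x_k)<m(x_{k-1})$. (d) $\omega\mapsto m(x_{k-1}+\omega\tau_k\mathbf{d}_k)$ is strictly decreasing on $(-\infty,1]$. (e) $\|x_k\|$ increases strictly monotonically with $k$, i.e. $\|x_k\|>\|x_{k-1}\|$. (f) $\omega\mapsto\|x_{k-1}+\omega\tau_k\mathbf{d}_k\|$ is strictly increasing on $[0,\infty)$. (g) $x_k^Tb$ increases strictly monotonically with $k$, i.e. $x_k^Tb>x_{k-1}^Tb$.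
   Context: Notation: $\|\cdot\|$ is the Euclidean norm; $\|x\|_A$ denotes the quadratic form $x^TAx$ (an abuse of notation; not a norm unless $A$ is positive definite, and possibly negative). The Krylov subspace is $\mathcal{K}_k(A,b)=\mathrm{Span}\{b,Ab,\dots,A^{k-1}b\}$. The grade of $b$ with respect to $A$ is the positive integer $g$ such that $\dim\mathcal{K}_k(A,b)=k$ for $k\le g$ and $=g$ for $k>g$. MINRES (exact arithmetic). Initialize $\beta_1=\|b\|$, $r_0=b$, $v_1=b/\beta_1$, $v_0=x_0=\mathbf{d}_0=\mathbf{d}_{-1}=0$, $c_0=-1$, $s_0=0$, $\phi_0=\tau_0=\beta_1$, $\delta_1^{(1)}=0$. For $k=1,2,\dots,g$: set $\alpha_k=v_k^TAv_k$, $p_k=Av_k-\beta_kv_{k-1}-\alpha_kv_k$, $\beta_{k+1}=\|p_k\|$; $\delta_k^{(2)}=c_{k-1}\delta_k^{(1)}+s_{k-1}\alpha_k$, $\gamma_k^{(1)}=s_{k-1}\delta_k^{(1)}-c_{k-1}\alpha_k$, $\epsilon_{k+1}=s_{k-1}\beta_{k+1}$, $\delta_{k+1}^{(1)}=-c_{k-1}\beta_{k+1}$, $\gamma_k^{(2)}=\sqrt{(\gamma_k^{(1)})^2+\beta_{k+1}^2}$. If $\gamma_k^{(2)}\ne0$: $c_k=\gamma_k^{(1)}/\gamma_k^{(2)}$, $s_k=\beta_{k+1}/\gamma_k^{(2)}$, $\tau_k=c_k\phi_{k-1}$, $\phi_k=s_k\phi_{k-1}$, $\mathbf{d}_k=(v_k-\delta_k^{(2)}\mathbf{d}_{k-1}-\epsilon_k\mathbf{d}_{k-2})/\gamma_k^{(2)}$,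 $x_k=x_{k-1}+\tau_k\mathbf{d}_k$, and, if $\beta_{k+1}\ne0$, $v_{k+1}=p_k/\beta_{k+1}$, $r_k=s_k^2r_{k-1}-\phi_kc_kv_{k+1}$, while if $\beta_{k+1}=0$, $r_k=0$ and the iteration stops. If $\gamma_k^{(2)}=0$: $c_k=0$, $s_k=1$, $\tau_k=0$, $\phi_k=\phi_{k-1}$, $r_k=r_{k-1}$, $x_k=x_{k-1}$ and the iteration stops. (The iterations are not stopped when the NPC condition below holds. The process stops after exactly $g$ iterations, $\beta_{k+1}>0$ for $k<g$, $\beta_{g+1}=0$; $x_k$ minimizes $\|b-Ax\|$ over $\mathcal{K}_k(A,b)$ and $r_k=b-Ax_k$.) NPC condition at iteration $k$: $c_{k-1}\gamma_k^{(1)}\ge0$. *)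

theory Defs
  imports "HOL-Analysis.Analysis"
begin

definition krylov :: "real^'d^'d \<Rightarrow> real^'d \<Rightarrow> nat \<Rightarrow> (real^'d) set" where
  "krylov A b k = span ((\<lambda>i. ((*v) A ^^ i) b) ` {..<k})"

definition is_grade :: "real^'d^'d \<Rightarrow> real^'d \<Rightarrow> nat \<Rightarrow> bool" where
  "is_grade A b g \<longleftrightarrow>
     g \<ge> 1 \<and> (\<forall>k\<le>g. dim (krylov A b k) = k) \<and> (\<forall>k>g. dim (krylov A b k) = g)"

text \<open>
  The state reached after \<open>k\<close> iterations. Quantities that are produced by iteration \<open>k\<close> but carry
  the index \<open>k + 1\<close> are stored here as well.
\<close>

record ('d::finite) minres_state =
  st_v :: "real^'d"        \<comment> \<open>\<open>v\<^sub>k\<close>\<close>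
  st_v_next :: "real^'d"   \<comment> \<open>\<open>v\<^sub>k\<^sub>+\<^sub>1\<close>\<close>
  st_beta :: real          \<comment> \<open>\<open>\<beta>\<^sub>k\<^sub>+\<^sub>1\<close>\<close>
  st_delta1 :: real        \<comment> \<open>\<open>\<delta>\<^sup>(\<^sup>1\<^sup>)\<close> with index \<open>k + 1\<close>\<close>
  st_epsilon :: real       \<comment> \<open>\<open>\<epsilon>\<^sub>k\<^sub>+\<^sub>1\<close>\<close>
  st_gamma1 :: real        \<comment> \<open>\<open>\<gamma>\<^sup>(\<^sup>1\<^sup>)\<close> with index \<open>k\<close>\<close>
  st_c :: real             \<comment> \<open>\<open>c\<^sub>k\<close>\<close>
  st_s :: real             \<comment> \<open>\<open>s\<^sub>k\<close>\<close>
  st_tau :: real           \<comment> \<open>\<open>\<tau>\<^sub>k\<close>\<close>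
  st_phi :: real           \<comment> \<open>\<open>\<phi>\<^sub>k\<close>\<close>
  st_d :: "real^'d"        \<comment> \<open>\<open>d\<^sub>k\<close>\<close>
  st_d_prev :: "real^'d"   \<comment> \<open>\<open>d\<^sub>k\<^sub>-\<^sub>1\<close>\<close>
  st_x :: "real^'d"        \<comment> \<open>\<open>x\<^sub>k\<close>\<close>
  st_r :: "real^'d"        \<comment> \<open>\<open>r\<^sub>k\<close>\<close>
  st_stopped :: bool

text \<open>
  \<open>\<epsilon>\<^sub>1\<close> is only ever multiplied by \<open>d\<^sub>-\<^sub>1 = 0\<close>, and \<open>\<gamma>\<^sub>0\<close> is never used; both are set to 0.
\<close>

definition minres_init :: "real^'d \<Rightarrow> 'd minres_state" where
  "minres_init b =
     \<lparr>st_v = 0, st_v_next = b /\<^sub>R norm b, st_beta = norm b,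
      st_delta1 = 0, st_epsilon = 0, st_gamma1 = 0,
      st_c = -1, st_s = 0, st_tau = norm b, st_phi = norm b,
      st_d = 0, st_d_prev = 0, st_x = 0, st_r = b, st_stopped = False\<rparr>"

text \<open>
  A stopped run stays in its final state. In the iteration that stops, \<open>v\<^sub>k\<^sub>+\<^sub>1\<close> (and \<open>d\<^sub>k\<close>, when
  \<open>\<gamma>\<^sup>(\<^sup>2\<^sup>) = 0\<close>) is not produced by the algorithm; 0 is stored instead.
\<close>

definition minres_step :: "real^'d^'d \<Rightarrow> 'd minres_state \<Rightarrow> 'd minres_state" where
  "minres_step A st =
    (if st_stopped st then st
     else
       let v = st_v_next st;
           \<beta> = st_beta st;
           \<delta>1 = st_delta1 st;
           \<epsilon> = st_epsilon st;
           c_prev = st_c st;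
           s_prev = st_s st;
           \<phi>_prev = st_phi st;
           \<alpha> = v \<bullet> (A *v v);
           p = A *v v - \<beta> *\<^sub>R st_v st - \<alpha> *\<^sub>R v;
           \<beta>_next = norm p;
           \<delta>2 = c_prev * \<delta>1 + s_prev * \<alpha>;
           \<gamma>1 = s_prev * \<delta>1 - c_prev * \<alpha>;
           \<epsilon>_next = s_prev * \<beta>_next;
           \<delta>1_next = - c_prev * \<beta>_next;
           \<gamma>2 = sqrt (\<gamma>1\<^sup>2 + \<beta>_next\<^sup>2)
       in
         if \<gamma>2 \<noteq> 0 then
           let c = \<gamma>1 / \<gamma>2;
               s = \<beta>_next / \<gamma>2;
               \<tau> = c * \<phi>_prev;
               \<phi> = s * \<phi>_prev;
               d = (v - \<delta>2 *\<^sub>R st_d st - \<epsilon> *\<^sub>R st_d_prev st) /\<^sub>R \<gamma>2;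
               x = st_x st + \<tau> *\<^sub>R d;
               v_next = (if \<beta>_next \<noteq> 0 then p /\<^sub>R \<beta>_next else 0);
               r = (if \<beta>_next \<noteq> 0 then s\<^sup>2 *\<^sub>R st_r st - (\<phi> * c) *\<^sub>R v_next else 0)
           in
             \<lparr>st_v = v, st_v_next = v_next, st_beta = \<beta>_next,
              st_delta1 = \<delta>1_next, st_epsilon = \<epsilon>_next, st_gamma1 = \<gamma>1,
              st_c = c, st_s = s, st_tau = \<tau>, st_phi = \<phi>,
              st_d = d, st_d_prev = st_d st, st_x = x, st_r = r,
              st_stopped = (\<beta>_next = 0)\<rparr>
         else
           \<lparr>st_v = v, st_v_next = 0, st_beta = \<beta>_next,
            st_delta1 = \<delta>1_next, st_epsilon = \<epsilon>_next, st_gamma1 = \<gamma>1,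
            st_c = 0, st_s = 1, st_tau = 0, st_phi = \<phi>_prev,
            st_d = 0, st_d_prev = st_d st, st_x = st_x st, st_r = st_r st,
            st_stopped = True\<rparr>)"

definition minres :: "real^'d^'d \<Rightarrow> real^'d \<Rightarrow> nat \<Rightarrow> 'd minres_state" where
  "minres A b k = (minres_step A ^^ k) (minres_init b)"

definition minres_x :: "real^'d^'d \<Rightarrow> real^'d \<Rightarrow> nat \<Rightarrow> real^'d" where
  "minres_x A b k = st_x (minres A b k)"

definition minres_d :: "real^'d^'d \<Rightarrow> real^'d \<Rightarrow> nat \<Rightarrow> real^'d" where
  "minres_d A b k = st_d (minres A b k)"

definition minres_tau :: "real^'d^'d \<Rightarrow> real^'d \<Rightarrow> nat \<Rightarrow> real" where
  "minres_tau A b k = st_tau (minres A b k)"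

text \<open>Nonpositive curvature (NPC) condition; only meaningful for \<open>k \<ge> 1\<close>.\<close>

definition npc :: "real^'d^'d \<Rightarrow> real^'d \<Rightarrow> nat \<Rightarrow> bool" where
  "npc A b k \<longleftrightarrow> st_c (minres A b (k - 1)) * st_gamma1 (minres A b k) \<ge> 0"

text \<open>The quadratic form, without a square root; it may be negative.\<close>

definition qform :: "real^'d^'d \<Rightarrow> real^'d \<Rightarrow> real" where
  "qform A x = x \<bullet> (A *v x)"

definition qmodel :: "real^'d^'d \<Rightarrow> real^'d \<Rightarrow> real^'d \<Rightarrow> real" where
  "qmodel A b x = 1 / 2 * (x \<bullet> (A *v x)) - b \<bullet> x"

end

theory Submission
  imports Defs
begin

text \<open>
  As long as no nonpositive curvature is detected, MINRES is the conjugate residual method in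
  disguise, and all the claimed monotonicities come from one fact about the steps
  \<open>q\<^sub>k = \<tau>\<^sub>k d\<^sub>k = x\<^sub>k - x\<^sub>k\<^sub>-\<^sub>1\<close>: each lies in the cone generated by the earlier residuals
  \<open>r\<^sub>0, \<dots>, r\<^sub>k\<^sub>-\<^sub>1\<close>, and these residuals have pairwise positive inner products.

  The inner products are explicit. By the Lanczos orthogonality of the \<open>v\<^sub>i\<close>, the recurrence
  \<open>r\<^sub>i = s\<^sub>i\<^sup>2 r\<^sub>i\<^sub>-\<^sub>1 - \<phi>\<^sub>i c\<^sub>i v\<^sub>i\<^sub>+\<^sub>1\<close> yields \<open>r\<^sub>j \<bullet> r\<^sub>i = \<phi>\<^sub>i\<^sup>2\<close> for \<open>j \<le> i\<close> (\<open>r_inner\<close>); below the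
  grade all \<open>\<phi>\<^sub>i\<close> are positive. With the unit residuals \<open>u\<^sub>i = r\<^sub>i / \<phi>\<^sub>i\<close>, the recurrence for \<open>d\<^sub>k\<close>
  collapses to a two-term one (\<open>u_eq_directions\<close>),
  \<open>u\<^sub>k\<^sub>-\<^sub>1 = s\<^sub>k\<^sub>-\<^sub>1 \<gamma>\<^sub>k\<^sup>(\<^sup>1\<^sup>) d\<^sub>k\<^sub>-\<^sub>1 - c\<^sub>k\<^sub>-\<^sub>1 \<gamma>\<^sub>k\<^sup>(\<^sup>2\<^sup>) d\<^sub>k\<close>.
  When \<open>c\<^sub>k\<^sub>-\<^sub>1 \<gamma>\<^sub>k\<^sup>(\<^sup>1\<^sup>) < 0\<close>, solving it for \<open>c\<^sub>k d\<^sub>k\<close> expresses this vector through \<open>u\<^sub>k\<^sub>-\<^sub>1\<close> and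
  \<open>c\<^sub>k\<^sub>-\<^sub>1 d\<^sub>k\<^sub>-\<^sub>1\<close> with nonnegative coefficients, that of \<open>u\<^sub>k\<^sub>-\<^sub>1\<close> being positive. The cone property
  follows by induction; it is used in dual form (\<open>update_in_residual_cone\<close>): a vector that has
  positive inner product with each of \<open>r\<^sub>0, \<dots>, r\<^sub>k\<^sub>-\<^sub>1\<close> has positive inner product with \<open>q\<^sub>k\<close>.

  Testing \<open>q\<^sub>k\<close> in this way against residuals, against other steps, and against
  \<open>r\<^sub>k\<^sub>-\<^sub>1 - r\<^sub>k = A q\<^sub>k\<close> gives \<open>q\<^sub>k \<bullet> r\<^sub>j > 0\<close>, \<open>q\<^sub>j \<bullet> q\<^sub>k > 0\<close> and \<open>q\<^sub>k \<bullet> A q\<^sub>k > 0\<close>. The case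
  \<open>r\<^sub>0 = b\<close> is the growth of \<open>x\<^sub>k \<bullet> b\<close>. As \<open>x\<^sub>k\<^sub>-\<^sub>1\<close> is a sum of earlier steps, \<open>x\<^sub>k\<^sub>-\<^sub>1 \<bullet> q\<^sub>k \<ge> 0\<close>, whence
  the growth of the norm. The quadratic \<open>m(x\<^sub>k\<^sub>-\<^sub>1 + \<omega> q\<^sub>k)\<close> is strictly convex in \<open>\<omega>\<close> and has slope
  \<open>- q\<^sub>k \<bullet> r\<^sub>k < 0\<close> at \<open>\<omega> = 1\<close>, so that it decreases up to there. Finally
  the squared \<open>A\<close>-error equals \<open>2 m\<close> up to a constant.
\<close>

section \<open>One iteration\<close>

lemma minres_0: "minres A b 0 = minres_init b"
  by (simp add: minres_def)

lemma minres_Suc: "minres A b (Suc i) = minres_step A (minres A b i)"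
  by (simp add: minres_def)

text \<open>
  Also a stop caused by \<open>\<gamma>\<^sub>k\<^sup>(\<^sup>2\<^sup>) = 0\<close> has \<open>\<beta>\<^sub>k\<^sub>+\<^sub>1 = 0\<close>, since \<open>\<gamma>\<^sub>k\<^sup>(\<^sup>2\<^sup>) \<ge> \<beta>\<^sub>k\<^sub>+\<^sub>1\<close>. So nonzero \<open>\<beta>\<close> is all
  that has to be known about a run in order to unfold its iterations.
\<close>

lemma minres_stopped_imp_beta_0:
  assumes "st_stopped (minres A b i)"
  shows "st_beta (minres A b i) = 0"
  using assms
proof (induction i)
  case 0
  then show ?case by (simp add: minres_0 minres_init_def)
next
  case (Suc i)
  show ?case
  proof (cases "st_stopped (minres A b i)")
    case True
    then show ?thesis using Suc.IH by (simp add: minres_Suc minres_step_def)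
  next
    case False
    then show ?thesis using Suc.prems
      by (auto simp: minres_Suc minres_step_def Let_def split: if_splits)
  qed
qed

text \<open>
  The part of an iteration that has the same form whether or not it is the last one.
\<close>

lemma minres_step_running:
  fixes A :: "real^'d^'d" and st :: "'d minres_state"
  assumes "\<not> st_stopped st"
  defines "st' \<equiv> minres_step A st" and "v \<equiv> st_v_next st"
  defines "\<alpha> \<equiv> v \<bullet> (A *v v)"
  shows "st_v st' = v"
    and "st_d_prev st' = st_d st"
    and "A *v v = st_beta st' *\<^sub>R st_v_next st' + \<alpha> *\<^sub>R v + st_beta st *\<^sub>R st_v st"
    and "st_beta st' \<ge> 0"
    and "st_gamma1 st' = st_s st * st_delta1 st - st_c st * \<alpha>"
    and "st_delta1 st' = - st_c st * st_beta st'"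
    and "st_epsilon st' = st_s st * st_beta st'"
  using assms(1) unfolding st'_def \<alpha>_def v_def
  by (auto simp: minres_step_def Let_def diff_eq_eq)

lemma minres_step_continuing:
  fixes A :: "real^'d^'d" and st :: "'d minres_state"
  assumes "\<not> st_stopped st"
  defines "st' \<equiv> minres_step A st" and "v \<equiv> st_v_next st"
  defines "\<gamma>2 \<equiv> sqrt ((st_gamma1 st')\<^sup>2 + (st_beta st')\<^sup>2)"
  assumes beta: "st_beta st' \<noteq> 0"
  shows "norm (st_v_next st') = 1"
    and "\<gamma>2 > 0"
    and "st_c st' = st_gamma1 st' / \<gamma>2"
    and "st_s st' = st_beta st' / \<gamma>2"
    and "st_tau st' = st_c st' * st_phi st"
    and "st_phi st' = st_s st' * st_phi st"
    and "\<gamma>2 *\<^sub>R st_d st' = v - (st_c st * st_delta1 st + st_s st * (v \<bullet> (A *v v))) *\<^sub>R st_d st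
           - st_epsilon st *\<^sub>R st_d_prev st"
    and "st_x st' = st_x st + st_tau st' *\<^sub>R st_d st'"
    and "st_r st' = (st_s st')\<^sup>2 *\<^sub>R st_r st - (st_phi st' * st_c st') *\<^sub>R st_v_next st'"
proof -
  show pos: "\<gamma>2 > 0"
    using beta unfolding \<gamma>2_def by (simp add: add_nonneg_pos)
  define p where "p = A *v v - st_beta st *\<^sub>R st_v st - (v \<bullet> (A *v v)) *\<^sub>R v"
  have "p \<noteq> 0"
    using beta assms(1) unfolding st'_def v_def p_def
    by (auto simp: minres_step_def Let_def split: if_splits)
  with assms(1)
  show "norm (st_v_next st') = 1" "st_c st' = st_gamma1 st' / \<gamma>2"
     "st_s st' = st_beta st' / \<gamma>2"
     "st_tau st' = st_c st' * st_phi st"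
     "st_phi st' = st_s st' * st_phi st"
     "\<gamma>2 *\<^sub>R st_d st' = v - (st_c st * st_delta1 st + st_s st * (v \<bullet> (A *v v))) *\<^sub>R st_d st
           - st_epsilon st *\<^sub>R st_d_prev st"
     "st_x st' = st_x st + st_tau st' *\<^sub>R st_d st'"
     "st_r st' = (st_s st')\<^sup>2 *\<^sub>R st_r st - (st_phi st' * st_c st') *\<^sub>R st_v_next st'"
    unfolding st'_def v_def \<gamma>2_def p_def
    by (simp_all add: minres_step_def Let_def)
qed

section \<open>The Lanczos process\<close>

text \<open>
  A run with \<open>\<beta>\<^sub>1, \<dots>, \<beta>\<^sub>n\<close> all nonzero, so that \<open>v\<^sub>1, \<dots>, v\<^sub>n\<close> exist and iteration \<open>n\<close> is carried out.
  The value \<open>\<beta>\<^sub>n\<^sub>+\<^sub>1\<close> that it produces is left open, so that the three-term recurrence for \<open>v\<^sub>1, \<dots>, v\<^sub>n\<close> can be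
  used to show that it is nonzero when \<open>n\<close> is below the grade.
\<close>

locale minres_run =
  fixes A :: "real^'d^'d" and b :: "real^'d" and n :: nat
  assumes symmetric: "transpose A = A"
    and beta_nz: "\<And>i. i < n \<Longrightarrow> st_beta (minres A b i) \<noteq> 0"
begin

text \<open>
  A suffix \<open>next\<close> marks a quantity that the state after \<open>i\<close> iterations stores for index \<open>i + 1\<close>;
  for instance \<open>beta_next i\<close> is \<open>\<beta>\<^sub>i\<^sub>+\<^sub>1\<close>.
\<close>

abbreviation "v i \<equiv> st_v (minres A b i)"
abbreviation "v_next i \<equiv> st_v_next (minres A b i)"
abbreviation "beta_next i \<equiv> st_beta (minres A b i)"
abbreviation "delta1_next i \<equiv> st_delta1 (minres A b i)"
abbreviation "eps_next i \<equiv> st_epsilon (minres A b i)"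
abbreviation "gamma1 i \<equiv> st_gamma1 (minres A b i)"
abbreviation "c i \<equiv> st_c (minres A b i)"
abbreviation "s i \<equiv> st_s (minres A b i)"
abbreviation "tau i \<equiv> st_tau (minres A b i)"
abbreviation "phi i \<equiv> st_phi (minres A b i)"
abbreviation "d i \<equiv> st_d (minres A b i)"
abbreviation "d_prev i \<equiv> st_d_prev (minres A b i)"
abbreviation "x i \<equiv> st_x (minres A b i)"
abbreviation "r i \<equiv> st_r (minres A b i)"

abbreviation "alpha i \<equiv> v i \<bullet> (A *v v i)"
abbreviation "gamma2 i \<equiv> sqrt ((gamma1 i)\<^sup>2 + (beta_next i)\<^sup>2)"

lemma A_adjoint: "y \<bullet> (A *v z) = (A *v y) \<bullet> z"
  by (metis dot_lmul_matrix symmetric transpose_matrix_vector)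

lemma running: "i < n \<Longrightarrow> \<not> st_stopped (minres A b i)"
  using beta_nz minres_stopped_imp_beta_0 by blast

lemmas init = minres_0 minres_init_def

lemma v_Suc: "i < n \<Longrightarrow> v (Suc i) = v_next i"
  using minres_step_running(1)[OF running] by (simp add: minres_Suc)

lemma d_prev_Suc: "i < n \<Longrightarrow> d_prev (Suc i) = d i"
  using minres_step_running(2)[OF running] by (simp add: minres_Suc)

lemma three_term_next:
  "i < n \<Longrightarrow> A *v v (Suc i) =
     beta_next (Suc i) *\<^sub>R v_next (Suc i) + alpha (Suc i) *\<^sub>R v (Suc i) + beta_next i *\<^sub>R v i"
  using minres_step_running(3)[OF running, of i] v_Suc[of i] by (simp add: minres_Suc)

lemma three_term:
  "Suc i < n \<Longrightarrow> A *v v (Suc i) =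
     beta_next (Suc i) *\<^sub>R v (Suc (Suc i)) + alpha (Suc i) *\<^sub>R v (Suc i) + beta_next i *\<^sub>R v i"
  using three_term_next[of i] v_Suc[of "Suc i"] by simp

lemma beta_pos: "i < n \<Longrightarrow> beta_next i > 0"
proof (cases i)
  case 0
  then show "i < n \<Longrightarrow> beta_next i > 0" using beta_nz[of i] by (simp add: init)
next
  case (Suc j)
  then show "i < n \<Longrightarrow> beta_next i > 0"
    using beta_nz[of i] minres_step_running(4)[OF running, of j A] by (simp add: minres_Suc)
qed

lemma b_eq: "0 < n \<Longrightarrow> b = beta_next 0 *\<^sub>R v (Suc 0)"
  using beta_nz[of 0] v_Suc[of 0] by (simp add: init)

lemma v_0: "v 0 = 0"
  by (simp add: init)

lemma norm_v: "i < n \<Longrightarrow> norm (v (Suc i)) = 1"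
proof (cases i)
  case 0
  then show "i < n \<Longrightarrow> norm (v (Suc i)) = 1"
    using beta_nz[of i] v_Suc[of i] by (simp add: init)
next
  case (Suc j)
  then show "i < n \<Longrightarrow> norm (v (Suc i)) = 1"
    using beta_nz[of i] v_Suc[of i] minres_step_continuing(1)[OF running, of j]
    by (simp add: minres_Suc)
qed

lemma v_unit: "i < n \<Longrightarrow> v (Suc i) \<bullet> v (Suc i) = 1"
  using norm_v[of i] by (simp add: norm_eq_1)

text \<open>
  The usual Lanczos argument: \<open>v\<^sub>i \<bullet> A v\<^sub>l\<^sub>+\<^sub>1 = A v\<^sub>i \<bullet> v\<^sub>l\<^sub>+\<^sub>1\<close>, and \<open>A v\<^sub>i\<close> only reaches up to \<open>v\<^sub>i\<^sub>+\<^sub>1\<close>; so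
  the recurrence has to cancel just the components along \<open>v\<^sub>l\<close> and \<open>v\<^sub>l\<^sub>+\<^sub>1\<close>. The vector \<open>v\<^sub>0 = 0\<close> is
  included to avoid a special case for the first step.
\<close>

lemma v_orthogonal: "j \<le> n \<Longrightarrow> i < j \<Longrightarrow> v i \<bullet> v j = 0"
proof (induction j arbitrary: i rule: less_induct)
  case (less j)
  show ?case
  proof (cases "i = 0")
    case True
    then show ?thesis by (simp add: v_0)
  next
    case False
    then obtain h where h: "i = Suc h" using not0_implies_Suc by blast
    with less.prems obtain l where l: "j = Suc (Suc l)"
      by (metis less_imp_Suc_add add_Suc)
    have IH: "v p \<bullet> v q = 0" if "p < q" "q < j" for p q
      using less.IH[of q p] that less.prems by simp
    have IH': "v q \<bullet> v p = 0" if "p < q" "q < j" for p q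
      using IH[OF that] by (simp add: inner_commute)
    have "A *v v (Suc l) =
        beta_next (Suc l) *\<^sub>R v j + alpha (Suc l) *\<^sub>R v (Suc l) + beta_next l *\<^sub>R v l"
      using three_term[of l] less.prems l by simp
    from arg_cong[OF this, of "inner (v i)"] have e: "v i \<bullet> (A *v v (Suc l)) =
        beta_next (Suc l) * (v i \<bullet> v j) + alpha (Suc l) * (v i \<bullet> v (Suc l))
          + beta_next l * (v i \<bullet> v l)"
      by (simp only: inner_add_right inner_scaleR_right)
    obtain a where Avi: "A *v v i = beta_next i *\<^sub>R v (Suc i) + a *\<^sub>R v i + beta_next h *\<^sub>R v h"
      using three_term[of h] h less.prems by auto
    have "beta_next (Suc l) * (v i \<bullet> v j) = 0"
    proof -
      consider "i = Suc l" | "i = l" | "i < l" using less.prems l by linarith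
      then show ?thesis
      proof cases
        case 1
        then show ?thesis using e v_unit[of l] IH'[of l "Suc l"] l less.prems by simp
      next
        case 2
        have "(A *v v i) \<bullet> v (Suc l) = beta_next l"
          unfolding Avi inner_add_left inner_scaleR_left
          using 2 l h less.prems v_unit[of l] IH[of l "Suc l"] IH[of h "Suc l"] by simp
        then show ?thesis
          using e 2 l h less.prems v_unit[of h] IH[of l "Suc l"] by (simp add: A_adjoint)
      next
        case 3
        have "(A *v v i) \<bullet> v (Suc l) = 0"
          unfolding Avi inner_add_left inner_scaleR_left
          using 3 l h less.prems IH[of i "Suc l"] IH[of h "Suc l"] IH[of "Suc i" "Suc l"] by simp
        then show ?thesis
          using e 3 l less.prems IH[of i l] IH[of i "Suc l"] by (simp add: A_adjoint)
      qed
    qed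
    then show ?thesis using beta_nz[of "Suc l"] l less.prems by simp
  qed
qed

text \<open>
  If \<open>\<beta>\<^sub>n\<^sub>+\<^sub>1 = 0\<close>, the span of \<open>v\<^sub>1, \<dots>, v\<^sub>n\<close> is invariant under \<open>A\<close> and contains \<open>b\<close>. It then contains
  every Krylov space, so none of them has dimension \<open>n + 1\<close>.
\<close>

lemma beta_next_nz_below_grade:
  assumes "is_grade A b g" and "0 < n" and "n < g"
  shows "beta_next n \<noteq> 0"
proof
  assume zero: "beta_next n = 0"
  define W where "W = span (v ` {1..n})"
  have vW: "v i \<in> W" if "i \<le> n" for i
  proof (cases i)
    case 0
    then show ?thesis by (simp add: v_0 W_def span_zero)
  next
    case (Suc j)
    then show ?thesis using that by (auto simp: W_def intro!: span_base)
  qed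
  have AvW: "A *v v (Suc i) \<in> W" if "i < n" for i
  proof -
    have "beta_next (Suc i) *\<^sub>R v_next (Suc i) \<in> W"
    proof (cases "Suc i = n")
      case True
      then show ?thesis using zero by (simp add: W_def span_zero)
    next
      case False
      then show ?thesis
        using v_Suc[of "Suc i"] vW[of "Suc (Suc i)"] that by (simp add: W_def span_scale)
    qed
    moreover have "a *\<^sub>R v (Suc i) \<in> W" "beta_next i *\<^sub>R v i \<in> W" for a
      using vW[of "Suc i"] vW[of i] that by (simp_all add: W_def span_scale)
    ultimately show ?thesis
      unfolding W_def by (subst three_term_next[OF that]) (intro span_add)
  qed
  have inv: "A *v w \<in> W" if "w \<in> W" for w
    using that unfolding W_def
  proof (induction rule: span_induct_alt)
    case base
    then show ?case by (simp add: span_zero)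
  next
    case (step a y z)
    then obtain h where h: "y = v h" "1 \<le> h" "h \<le> n" by auto
    then obtain i where "h = Suc i" by (cases h) auto
    with h AvW[of i] have "A *v y \<in> span (v ` {1..n})" by (simp add: W_def)
    with step show ?case
      by (simp only: matrix_vector_right_distrib matrix_vector_mult_scaleR span_add span_scale)
  qed
  have "((*v) A ^^ i) b \<in> W" for i
  proof (induction i)
    case 0
    have "v (Suc 0) \<in> W" using vW assms(2) by simp
    then have "beta_next 0 *\<^sub>R v (Suc 0) \<in> W" unfolding W_def by (rule span_scale)
    then show ?case by (simp flip: b_eq[OF assms(2)])
  next
    case (Suc i)
    then show ?case using inv by simp
  qed
  then have "krylov A b (Suc n) \<subseteq> W"
    unfolding krylov_def W_def by (intro span_minimal) (auto simp: subspace_span)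
  then have "dim (krylov A b (Suc n)) \<le> dim (v ` {1..n})"
    using dim_subset[of "krylov A b (Suc n)" W] by (simp add: W_def)
  also have "\<dots> \<le> card (v ` {1..n})"
    by (rule dim_le_card') simp
  also have "\<dots> \<le> n"
    using card_image_le[of "{1..n}" v] by simp
  finally show False
    using assms(1,3) unfolding is_grade_def by (metis Suc_leI Suc_n_not_le_n)
qed

section \<open>Residuals\<close>

lemma beta_next_Suc_step: "Suc i < n \<Longrightarrow> st_beta (minres_step A (minres A b i)) \<noteq> 0"
  using beta_nz[of "Suc i"] by (simp add: minres_Suc)

lemmas continuing =
  minres_step_continuing[OF running beta_next_Suc_step, folded minres_Suc]

lemma gamma2_pos: "Suc i < n \<Longrightarrow> gamma2 (Suc i) > 0"
  using continuing(2)[of i] by simp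

lemma c_Suc: "Suc i < n \<Longrightarrow> c (Suc i) = gamma1 (Suc i) / gamma2 (Suc i)"
  using continuing(3)[of i] by simp

lemma s_Suc: "Suc i < n \<Longrightarrow> s (Suc i) = beta_next (Suc i) / gamma2 (Suc i)"
  using continuing(4)[of i] by simp

lemma tau_Suc: "Suc i < n \<Longrightarrow> tau (Suc i) = c (Suc i) * phi i"
  using continuing(5)[of i] by simp

lemma phi_Suc: "Suc i < n \<Longrightarrow> phi (Suc i) = s (Suc i) * phi i"
  using continuing(6)[of i] by simp

lemma d_Suc:
  "Suc i < n \<Longrightarrow> gamma2 (Suc i) *\<^sub>R d (Suc i) =
     v (Suc i) - (c i * delta1_next i + s i * alpha (Suc i)) *\<^sub>R d i - eps_next i *\<^sub>R d_prev i"
  using continuing(7)[of i] v_Suc[of i] by simp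

lemma x_Suc: "Suc i < n \<Longrightarrow> x (Suc i) = x i + tau (Suc i) *\<^sub>R d (Suc i)"
  using continuing(8)[of i] by simp

lemma r_Suc:
  "Suc i < n \<Longrightarrow> r (Suc i) =
     (s (Suc i))\<^sup>2 *\<^sub>R r i - (phi (Suc i) * c (Suc i)) *\<^sub>R v (Suc (Suc i))"
  using continuing(9)[of i] v_Suc[of "Suc i"] by simp

lemma gamma1_Suc: "i < n \<Longrightarrow> gamma1 (Suc i) = s i * delta1_next i - c i * alpha (Suc i)"
  using minres_step_running(5)[OF running, of i] v_Suc[of i] by (simp add: minres_Suc)

lemma delta1_Suc: "i < n \<Longrightarrow> delta1_next (Suc i) = - c i * beta_next (Suc i)"
  using minres_step_running(6)[OF running, of i] by (simp add: minres_Suc)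

lemma eps_Suc: "i < n \<Longrightarrow> eps_next (Suc i) = s i * beta_next (Suc i)"
  using minres_step_running(7)[OF running, of i] by (simp add: minres_Suc)

lemma c_s_rotation: "i < n \<Longrightarrow> (c i)\<^sup>2 + (s i)\<^sup>2 = 1"
proof (cases i)
  case 0
  then show ?thesis by (simp add: init)
next
  case (Suc j)
  assume "i < n"
  with Suc have "beta_next (Suc j) \<noteq> 0" and j: "Suc j < n" using beta_nz by auto
  then have "(gamma1 (Suc j))\<^sup>2 + (beta_next (Suc j))\<^sup>2 \<noteq> 0" by simp
  then show ?thesis unfolding Suc
    by (simp add: c_Suc s_Suc j power_divide flip: add_divide_distrib)
qed

lemma s_Suc_pos: "Suc i < n \<Longrightarrow> s (Suc i) > 0"
  using gamma2_pos[of i] beta_pos[of "Suc i"] by (simp add: s_Suc)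

lemma phi_pos: "i < n \<Longrightarrow> phi i > 0"
proof (induction i)
  case 0
  then show ?case using beta_pos[of 0] by (simp add: init)
next
  case (Suc i)
  then show ?case using s_Suc_pos[of i] by (simp add: phi_Suc)
qed

lemma r_0: "r 0 = b"
  by (simp add: init)

lemma r_orthogonal_later_v: "i < n \<Longrightarrow> Suc i < j \<Longrightarrow> j \<le> n \<Longrightarrow> r i \<bullet> v j = 0"
proof (induction i)
  case 0
  have "r 0 = beta_next 0 *\<^sub>R v (Suc 0)" using b_eq 0 by (simp add: r_0)
  then show ?case using v_orthogonal[of j "Suc 0"] 0 by simp
next
  case (Suc i)
  then show ?case using v_orthogonal[of j "Suc (Suc i)"]
    by (simp add: r_Suc inner_diff_left)
qed

text \<open>
  Since \<open>v\<^sub>i\<^sub>+\<^sub>1\<close> is orthogonal to all earlier residuals, passing from \<open>r\<^sub>i\<^sub>-\<^sub>1\<close> to \<open>r\<^sub>i\<close> scales their inner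
  products with it by \<open>s\<^sub>i\<^sup>2\<close>. That \<open>\<phi>\<^sub>i\<close> is also the norm of \<open>r\<^sub>i\<close> comes from \<open>c\<^sub>i\<^sup>2 + s\<^sub>i\<^sup>2 = 1\<close>.
\<close>

lemma r_inner: "i < n \<Longrightarrow> j \<le> i \<Longrightarrow> r j \<bullet> r i = (phi i)\<^sup>2"
proof (induction i arbitrary: j)
  case 0
  then show ?case by (simp add: init power2_norm_eq_inner)
next
  case (Suc i)
  have earlier: "r h \<bullet> r (Suc i) = (phi (Suc i))\<^sup>2" if "h \<le> i" for h
    using Suc that r_orthogonal_later_v[of h "Suc (Suc i)"]
    by (simp add: r_Suc inner_diff_right phi_Suc power_mult_distrib)
  show ?case
  proof (cases "j = Suc i")
    case False
    then show ?thesis using earlier Suc.prems by simp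
  next
    case True
    have v2: "v (Suc (Suc i)) \<bullet> r (Suc i) = - (phi (Suc i) * c (Suc i))"
      using Suc.prems r_orthogonal_later_v[of i "Suc (Suc i)"] v_unit[of "Suc i"]
      by (simp add: r_Suc inner_diff_right inner_commute)
    have "r (Suc i) \<bullet> r (Suc i) =
        (s (Suc i))\<^sup>2 * (r i \<bullet> r (Suc i)) - phi (Suc i) * c (Suc i) * (v (Suc (Suc i)) \<bullet> r (Suc i))"
      using r_Suc[OF Suc.prems(1)] by (metis inner_diff_left inner_scaleR_left)
    also have "\<dots> = ((s (Suc i))\<^sup>2 + (c (Suc i))\<^sup>2) * (phi (Suc i))\<^sup>2"
      unfolding v2 earlier[OF order_refl] by (simp add: algebra_simps power2_eq_square)
    also have "\<dots> = (phi (Suc i))\<^sup>2"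
      using c_s_rotation[OF Suc.prems(1)] by (simp add: add.commute)
    finally show ?thesis using True by simp
  qed
qed

lemma r_inner_pos: "i < n \<Longrightarrow> j < n \<Longrightarrow> r j \<bullet> r i > 0"
proof (cases "j \<le> i")
  case True
  assume "i < n" "j < n"
  then show ?thesis using True phi_pos[of i] by (simp add: r_inner)
next
  case False
  assume "i < n" "j < n"
  then show ?thesis using False phi_pos[of j] r_inner[of j i] by (simp add: inner_commute)
qed

definition u where "u i = r i /\<^sub>R phi i"

text \<open>
  This is \<open>u\<^sub>i\<^sub>-\<^sub>1\<close>. The value \<open>u\<^sub>-\<^sub>1 = 0\<close> agrees with the initial data \<open>c\<^sub>0 = -1\<close>, \<open>s\<^sub>0 = 0\<close>, \<open>d\<^sub>0 = 0\<close> and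
  makes the relations below hold from \<open>i = 0\<close> on.
\<close>

definition u_prev where "u_prev i = (case i of 0 \<Rightarrow> 0 | Suc j \<Rightarrow> u j)"

lemma r_eq_u: "i < n \<Longrightarrow> r i = phi i *\<^sub>R u i"
  using phi_pos[of i] by (simp add: u_def)

text \<open>
  Together with the formula for \<open>A d\<^sub>i\<close> below, this says for \<open>i \<ge> 1\<close> that \<open>(A d\<^sub>i, u\<^sub>i)\<close> is the image of the
  orthonormal pair \<open>(u\<^sub>i\<^sub>-\<^sub>1, v\<^sub>i\<^sub>+\<^sub>1)\<close> under the reflection with entries \<open>c\<^sub>i\<close> and \<open>s\<^sub>i\<close>.
\<close>

lemma u_rotation: "i < n \<Longrightarrow> u i = s i *\<^sub>R u_prev i - c i *\<^sub>R v (Suc i)"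
proof (cases i)
  case 0
  assume "i < n"
  with 0 show ?thesis
    using v_Suc[of 0] by (simp add: u_def u_prev_def init)
next
  case (Suc j)
  assume "i < n"
  with Suc have *: "phi i \<noteq> 0" "phi j \<noteq> 0" "s i \<noteq> 0" "Suc j < n"
    using phi_pos[of i] phi_pos[of j] s_Suc_pos[of j] by auto
  have "u i = ((s i)\<^sup>2 / phi i) *\<^sub>R r j - (phi i * c i / phi i) *\<^sub>R v (Suc i)"
    unfolding u_def using Suc * by (simp add: r_Suc scaleR_diff_right divide_inverse_commute)
  also have "(s i)\<^sup>2 / phi i = s i / phi j"
    using Suc * phi_Suc[of j] by (simp add: power2_eq_square field_simps)
  finally show ?thesis
    using Suc * by (simp add: u_prev_def u_def divide_inverse)
qed

text \<open>
  The first formula is what \<open>r\<^sub>i = b - A x\<^sub>i\<close> rests on. The second keeps it inductive: it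
  absorbs the terms \<open>v\<^sub>i\<close> and \<open>d\<^sub>i\<^sub>-\<^sub>1\<close> of the next recurrences into a multiple of \<open>u\<^sub>i\<^sub>-\<^sub>1\<close>, after which only
  the pair \<open>(u\<^sub>i\<^sub>-\<^sub>1, v\<^sub>i\<^sub>+\<^sub>1)\<close> is left and the reflection applies.
\<close>

lemma image_invariants:
  "i < n \<Longrightarrow> A *v d i = c i *\<^sub>R u_prev i + s i *\<^sub>R v (Suc i)
    \<and> beta_next i *\<^sub>R v i - eps_next i *\<^sub>R (A *v d_prev i) = delta1_next i *\<^sub>R u_prev i"
proof (induction i)
  case 0
  then show ?case by (simp add: init u_prev_def)
next
  case (Suc i)
  \<comment> \<open>An opaque name: \<open>\<alpha>\<^sub>i\<^sub>+\<^sub>1\<close> itself contains \<open>A *v v (Suc i)\<close>, so rewriting by the recurrence would loop.\<close>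
  define a where "a = alpha (Suc i)"
  let ?w = "u_prev i" and ?v = "v (Suc i)" and ?\<delta> = "c i * delta1_next i + s i * a"
  have i: "i < n" using Suc.prems by simp
  have Ad: "A *v d i = c i *\<^sub>R ?w + s i *\<^sub>R ?v"
    and low: "beta_next i *\<^sub>R v i - eps_next i *\<^sub>R (A *v d_prev i) = delta1_next i *\<^sub>R ?w"
    using Suc by simp_all
  have rot: "(c i)\<^sup>2 + (s i)\<^sup>2 = 1" by (rule c_s_rotation[OF i])
  have up: "u_prev (Suc i) = s i *\<^sub>R ?w - c i *\<^sub>R ?v"
    using u_rotation[OF i] by (simp add: u_prev_def)
  have g2: "gamma2 (Suc i) > 0" by (rule gamma2_pos[OF Suc.prems])
  have "gamma2 (Suc i) *\<^sub>R (A *v d (Suc i)) = A *v (gamma2 (Suc i) *\<^sub>R d (Suc i))"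
    by (simp add: matrix_vector_mult_scaleR)
  also have "\<dots> = A *v ?v - ?\<delta> *\<^sub>R (A *v d i) - eps_next i *\<^sub>R (A *v d_prev i)"
    unfolding d_Suc[OF Suc.prems, folded a_def]
    by (simp add: matrix_vector_mult_diff_distrib matrix_vector_mult_scaleR)
  also have "\<dots> = beta_next (Suc i) *\<^sub>R v (Suc (Suc i)) + a *\<^sub>R ?v
      + delta1_next i *\<^sub>R ?w - ?\<delta> *\<^sub>R (c i *\<^sub>R ?w + s i *\<^sub>R ?v)"
    unfolding three_term[OF Suc.prems, folded a_def] Ad low[symmetric] by simp
  also have "\<dots> = beta_next (Suc i) *\<^sub>R v (Suc (Suc i))
      + (a - ?\<delta> * s i) *\<^sub>R ?v + (delta1_next i - ?\<delta> * c i) *\<^sub>R ?w"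
    by (simp add: algebra_simps)
  also have "a - ?\<delta> * s i = - gamma1 (Suc i) * c i"
    unfolding gamma1_Suc[OF i, folded a_def] using rot by algebra
  also have "delta1_next i - ?\<delta> * c i = gamma1 (Suc i) * s i"
    unfolding gamma1_Suc[OF i, folded a_def] using rot by algebra
  finally have "gamma2 (Suc i) *\<^sub>R (A *v d (Suc i)) =
      gamma1 (Suc i) *\<^sub>R u_prev (Suc i) + beta_next (Suc i) *\<^sub>R v (Suc (Suc i))"
    unfolding up by (simp add: algebra_simps)
  also have "\<dots> = gamma2 (Suc i) *\<^sub>R (c (Suc i) *\<^sub>R u_prev (Suc i) + s (Suc i) *\<^sub>R v (Suc (Suc i)))"
    using g2 by (simp add: c_Suc s_Suc Suc.prems scaleR_add_right)
  finally have first: "A *v d (Suc i) =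
      c (Suc i) *\<^sub>R u_prev (Suc i) + s (Suc i) *\<^sub>R v (Suc (Suc i))"
    using g2 by (metis less_irrefl real_vector.scale_left_imp_eq)
  have "beta_next (Suc i) *\<^sub>R ?v - eps_next (Suc i) *\<^sub>R (A *v d_prev (Suc i)) =
      (beta_next (Suc i) * (1 - (s i)\<^sup>2)) *\<^sub>R ?v - (beta_next (Suc i) * s i * c i) *\<^sub>R ?w"
    by (simp add: eps_Suc[OF i] d_prev_Suc[OF i] Ad algebra_simps power2_eq_square)
  also have "1 - (s i)\<^sup>2 = c i * c i" using rot by (simp add: power2_eq_square)
  also have "(beta_next (Suc i) * (c i * c i)) *\<^sub>R ?v - (beta_next (Suc i) * s i * c i) *\<^sub>R ?w
      = delta1_next (Suc i) *\<^sub>R u_prev (Suc i)"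
    by (simp add: delta1_Suc[OF i] up algebra_simps)
  finally show ?case using first by simp
qed

lemma A_d_Suc: "Suc i < n \<Longrightarrow> A *v d (Suc i) = c (Suc i) *\<^sub>R u i + s (Suc i) *\<^sub>R v (Suc (Suc i))"
  using image_invariants[of "Suc i"] by (simp add: u_prev_def)

lemma residual_eq: "i < n \<Longrightarrow> r i = b - A *v x i"
proof (induction i)
  case 0
  then show ?case by (simp add: init)
next
  case (Suc i)
  have "b - A *v x (Suc i) = r i - tau (Suc i) *\<^sub>R (A *v d (Suc i))"
    using Suc by (simp add: x_Suc matrix_vector_right_distrib matrix_vector_mult_scaleR)
  also have "\<dots> = (1 - c (Suc i) * c (Suc i)) *\<^sub>R r i
      - (phi (Suc i) * c (Suc i)) *\<^sub>R v (Suc (Suc i))"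
    using Suc.prems by (simp add: A_d_Suc tau_Suc phi_Suc r_eq_u algebra_simps)
  also have "1 - c (Suc i) * c (Suc i) = (s (Suc i))\<^sup>2"
    using c_s_rotation[OF Suc.prems] by (simp add: power2_eq_square)
  finally show ?case using Suc.prems by (simp add: r_Suc)
qed

section \<open>Search directions as conjugate residual directions\<close>

text \<open>
  The coupling between residuals and directions of the conjugate residual method. In the step from
  \<open>i\<close> to \<open>i + 1\<close>, replacing \<open>u\<^sub>i\<close> and \<open>v\<^sub>i\<^sub>+\<^sub>2\<close> in \<open>u_rotation\<close> by the induction hypothesis and the
  recurrence for \<open>d\<close> leaves three directions; the coefficient of the oldest vanishes because \<open>s\<^sub>i\<^sub>+\<^sub>1 \<gamma>\<^sub>i\<^sub>+\<^sub>1\<^sup>(\<^sup>1\<^sup>) = c\<^sub>i\<^sub>+\<^sub>1 \<beta>\<^sub>i\<^sub>+\<^sub>2\<close>, both being \<open>\<beta>\<^sub>i\<^sub>+\<^sub>2 \<gamma>\<^sub>i\<^sub>+\<^sub>1\<^sup>(\<^sup>1\<^sup>) / \<gamma>\<^sub>i\<^sub>+\<^sub>1\<^sup>(\<^sup>2\<^sup>)\<close>.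
\<close>

lemma u_eq_directions:
  "Suc i < n \<Longrightarrow>
    u i = (s i * gamma1 (Suc i)) *\<^sub>R d i - (c i * gamma2 (Suc i)) *\<^sub>R d (Suc i)"
proof (induction i)
  case 0
  have "gamma2 (Suc 0) *\<^sub>R d (Suc 0) = v (Suc 0)"
    using d_Suc[OF 0] by (simp add: init)
  then show ?case
    using u_rotation[of 0] 0 by (simp add: init u_prev_def)
next
  case (Suc i)
  let ?j = "Suc i"
  have i: "Suc i < n" "i < n" using Suc.prems by simp_all
  define a where "a = alpha (Suc ?j)"
  let ?\<delta> = "c ?j * delta1_next ?j + s ?j * a"
  have g2: "gamma2 ?j > 0" by (rule gamma2_pos[OF i(1)])
  have rot: "(c ?j)\<^sup>2 + (s ?j)\<^sup>2 = 1" by (rule c_s_rotation[OF i(1)])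
  have sg: "s ?j * gamma2 ?j = beta_next ?j" using g2 by (simp add: s_Suc i)
  have v: "v (Suc ?j) = gamma2 (Suc ?j) *\<^sub>R d (Suc ?j) + ?\<delta> *\<^sub>R d ?j + eps_next ?j *\<^sub>R d i"
    using d_Suc[OF Suc.prems, folded a_def] d_prev_Suc[OF i(2)] by simp
  have "u ?j = s ?j *\<^sub>R u i - c ?j *\<^sub>R v (Suc ?j)"
    using u_rotation[OF i(1)] by (simp add: u_prev_def)
  also have "\<dots> = (s ?j * s i * gamma1 ?j - c ?j * eps_next ?j) *\<^sub>R d i
      + (- c i * (s ?j * gamma2 ?j) - c ?j * ?\<delta>) *\<^sub>R d ?j
      - (c ?j * gamma2 (Suc ?j)) *\<^sub>R d (Suc ?j)"
    unfolding v Suc.IH[OF i(1)] by (simp add: algebra_simps)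
  also have "s ?j * s i * gamma1 ?j - c ?j * eps_next ?j = 0"
    by (simp add: eps_Suc i s_Suc c_Suc)
  also have "- c i * (s ?j * gamma2 ?j) - c ?j * ?\<delta> = s ?j * gamma1 (Suc ?j)"
    unfolding sg gamma1_Suc[OF i(1), folded a_def] delta1_Suc[OF i(2)] using rot by algebra
  finally show ?case by simp
qed

text \<open>
  Here \<open>c\<^sub>j \<gamma>\<^sub>j\<^sub>+\<^sub>1\<^sup>(\<^sup>1\<^sup>) < 0\<close> says that the NPC condition fails at iteration \<open>j + 1\<close>. It makes \<open>- c\<^sub>i\<close> and
  \<open>\<gamma>\<^sub>i\<^sub>+\<^sub>1\<^sup>(\<^sup>1\<^sup>)\<close>, hence also \<open>c\<^sub>i\<^sub>+\<^sub>1\<close>, agree in sign. So the \<open>c\<^sub>i\<close> alternate in sign, which is why the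
  claim concerns \<open>c\<^sub>i\<^sub>+\<^sub>1 d\<^sub>i\<^sub>+\<^sub>1\<close> and not \<open>d\<^sub>i\<^sub>+\<^sub>1\<close>. The cone is described by its dual, because
  only inner products with members of the cone are ever taken.
\<close>

lemma direction_in_residual_cone:
  assumes "Suc i < n" and "\<And>j. j \<le> i \<Longrightarrow> c j * gamma1 (Suc j) < 0"
    and "\<And>j. j \<le> i \<Longrightarrow> r j \<bullet> y > 0"
  shows "c (Suc i) * (d (Suc i) \<bullet> y) > 0"
  using assms
proof (induction i)
  case 0
  have "u 0 = gamma2 (Suc 0) *\<^sub>R d (Suc 0)"
    using u_eq_directions[OF 0(1)] by (simp add: init)
  then have "gamma2 (Suc 0) * (d (Suc 0) \<bullet> y) = u 0 \<bullet> y" by simp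
  moreover have "u 0 \<bullet> y > 0" using 0(3)[of 0] phi_pos[of 0] 0(1) by (simp add: u_def)
  moreover have "gamma2 (Suc 0) > 0" by (rule gamma2_pos[OF 0(1)])
  ultimately have "d (Suc 0) \<bullet> y > 0" by (metis zero_less_mult_pos)
  moreover have "c (Suc 0) > 0"
    using 0(2)[of 0] gamma2_pos[OF 0(1)] by (simp add: c_Suc 0(1) init)
  ultimately show ?case by simp
next
  case (Suc i)
  let ?j = "Suc i"
  have j: "?j < n" using Suc.prems(1) by simp
  have IH: "c ?j * (d ?j \<bullet> y) > 0" using Suc.IH[OF j] Suc.prems by simp
  have npc: "c ?j * gamma1 (Suc ?j) < 0" using Suc.prems(2)[of ?j] by simp
  have g2: "gamma2 (Suc ?j) > 0" by (rule gamma2_pos[OF Suc.prems(1)])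
  have sp: "s ?j > 0" by (rule s_Suc_pos[OF j])
  have up: "u ?j \<bullet> y > 0" using Suc.prems(3)[of ?j] phi_pos[OF j] by (simp add: u_def)
  have e: "u ?j \<bullet> y = s ?j * gamma1 (Suc ?j) * (d ?j \<bullet> y)
      - c ?j * gamma2 (Suc ?j) * (d (Suc ?j) \<bullet> y)"
    using u_eq_directions[OF Suc.prems(1)] by (simp add: inner_diff_left)
  have "gamma1 (Suc ?j) * (d ?j \<bullet> y) < 0"
    using IH npc by (auto simp: zero_less_mult_iff mult_less_0_iff)
  then have "s ?j * gamma1 (Suc ?j) * (d ?j \<bullet> y) < 0"
    using sp by (simp add: mult.assoc mult_pos_neg)
  with e up have "gamma2 (Suc ?j) * (c ?j * (d (Suc ?j) \<bullet> y)) < 0"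
    by (simp add: algebra_simps)
  then have "c ?j * (d (Suc ?j) \<bullet> y) < 0"
    using g2 by (auto simp: mult_less_0_iff)
  then have "gamma1 (Suc ?j) * (d (Suc ?j) \<bullet> y) > 0"
    using npc by (auto simp: zero_less_mult_iff mult_less_0_iff)
  then show ?case using g2 by (simp add: c_Suc Suc.prems(1))
qed

abbreviation "update i \<equiv> tau i *\<^sub>R d i"

lemma update_in_residual_cone:
  assumes "Suc i < n" and "\<And>j. j \<le> i \<Longrightarrow> c j * gamma1 (Suc j) < 0"
    and "\<And>j. j \<le> i \<Longrightarrow> r j \<bullet> y > 0"
  shows "update (Suc i) \<bullet> y > 0"
  using direction_in_residual_cone[OF assms] phi_pos[of i] assms(1)
  by (simp add: tau_Suc mult.commute mult.left_commute)

lemma update_inner_residual_pos: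
  assumes "Suc i < n" and "\<And>j. j \<le> i \<Longrightarrow> c j * gamma1 (Suc j) < 0" and "h < n"
  shows "update (Suc i) \<bullet> r h > 0"
  using assms by (intro update_in_residual_cone) (auto intro: r_inner_pos)

text \<open>
  Two applications of the cone property: the step \<open>q\<^sub>i\<^sub>+\<^sub>1\<close> is positive on residuals, hence an
  admissible test vector for \<open>q\<^sub>h\<^sub>+\<^sub>1\<close>.
\<close>

lemma update_inner_update_pos:
  assumes "Suc i < n" and "\<And>j. j \<le> i \<Longrightarrow> c j * gamma1 (Suc j) < 0" and "h \<le> i"
  shows "update (Suc h) \<bullet> update (Suc i) > 0"
proof (rule update_in_residual_cone)
  fix j assume "j \<le> h"
  then show "r j \<bullet> update (Suc i) > 0"
    using update_inner_residual_pos[OF assms(1,2), of j] assms by (simp add: inner_commute)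
qed (use assms in auto)

lemma iterate_inner_update_nonneg:
  assumes "Suc i < n" and "\<And>j. j \<le> i \<Longrightarrow> c j * gamma1 (Suc j) < 0" and "h \<le> i"
  shows "x h \<bullet> update (Suc i) \<ge> 0"
  using assms(3)
proof (induction h)
  case 0
  then show ?case by (simp add: init)
next
  case (Suc h)
  have "update (Suc h) \<bullet> update (Suc i) > 0"
    using update_inner_update_pos[OF assms(1,2), of h] Suc.prems by simp
  with Suc assms(1) show ?case by (simp only: x_Suc inner_add_left) simp
qed

text \<open>
  The test vector is \<open>A q\<^sub>i\<^sub>+\<^sub>1 = r\<^sub>i - r\<^sub>i\<^sub>+\<^sub>1\<close>. Its inner product with every earlier residual is
  \<open>\<phi>\<^sub>i\<^sup>2 - \<phi>\<^sub>i\<^sub>+\<^sub>1\<^sup>2 = c\<^sub>i\<^sub>+\<^sub>1\<^sup>2 \<phi>\<^sub>i\<^sup>2\<close>.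
\<close>

lemma update_curvature_pos:
  assumes "Suc i < n" and "\<And>j. j \<le> i \<Longrightarrow> c j * gamma1 (Suc j) < 0"
  shows "update (Suc i) \<bullet> (A *v update (Suc i)) > 0"
proof -
  have i: "i < n" using assms(1) by simp
  have "A *v update (Suc i) = r i - r (Suc i)"
    unfolding residual_eq[OF i] residual_eq[OF assms(1)] x_Suc[OF assms(1)]
    by (simp add: matrix_vector_right_distrib)
  moreover have "update (Suc i) \<bullet> (r i - r (Suc i)) > 0"
  proof (rule update_in_residual_cone[OF assms])
    fix j assume j: "j \<le> i"
    have "gamma1 (Suc i) \<noteq> 0" using assms(2)[of i] by auto
    then have "c (Suc i) \<noteq> 0" using c_Suc[OF assms(1)] gamma2_pos[OF assms(1)] by simp
    then have "0 < (c (Suc i))\<^sup>2 * (phi i)\<^sup>2" using phi_pos[OF i] by simp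
    also have "\<dots> = (phi i)\<^sup>2 - (phi (Suc i))\<^sup>2"
      using c_s_rotation[OF assms(1)] unfolding phi_Suc[OF assms(1)] by algebra
    also have "\<dots> = r j \<bullet> (r i - r (Suc i))"
      using r_inner[OF i j] r_inner[of "Suc i" j] assms(1) j by (simp add: inner_diff_right)
    finally show "0 < r j \<bullet> (r i - r (Suc i))" .
  qed
  ultimately show ?thesis by simp
qed

end

section \<open>Monotonicity along a line\<close>

text \<open>
  The derivative \<open>m + \<omega> q\<close> increases and is at most \<open>0\<close> at \<open>\<omega> = 1\<close>.
\<close>

lemma quadratic_strict_antimono_on:
  fixes f :: "real \<Rightarrow> real"
  assumes f: "\<And>\<omega>. f \<omega> = a + \<omega> * m + \<omega>\<^sup>2 / 2 * q" and "q > 0" and "m + q \<le> 0"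
  shows "strict_antimono_on {..1} f"
proof (rule monotone_onI)
  fix s t :: real assume "s \<in> {..1}" "t \<in> {..1}" "s < t"
  then have "(s + t) / 2 < 1" by simp
  then have "(s + t) / 2 * q < 1 * q" using assms(2) by (rule mult_strict_right_mono)
  then have "m + (s + t) / 2 * q < 0" using assms(3) by linarith
  then have "(t - s) * (m + (s + t) / 2 * q) < 0"
    using \<open>s < t\<close> by (simp add: mult_pos_neg)
  moreover have "f t - f s = (t - s) * (m + (s + t) / 2 * q)"
    unfolding f by (simp add: field_simps power2_eq_square)
  ultimately show "f t < f s" by linarith
qed

lemma norm_line_strict_mono_on:
  fixes x q :: "'a::real_inner"
  assumes "x \<bullet> q \<ge> 0" and "q \<bullet> q > 0"
  shows "strict_mono_on {0..} (\<lambda>\<omega>. norm (x + \<omega> *\<^sub>R q))"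
proof (rule strict_mono_onI)
  fix s t :: real assume st: "s \<in> {0..}" "t \<in> {0..}" "s < t"
  have e: "(x + \<omega> *\<^sub>R q) \<bullet> (x + \<omega> *\<^sub>R q) = x \<bullet> x + \<omega> * (2 * (x \<bullet> q)) + \<omega>\<^sup>2 * (q \<bullet> q)" for \<omega>
    by (simp add: inner_add_left inner_add_right inner_commute power2_eq_square algebra_simps)
  have "s * (2 * (x \<bullet> q)) \<le> t * (2 * (x \<bullet> q))"
    using st assms(1) by (intro mult_right_mono) auto
  moreover have "s\<^sup>2 * (q \<bullet> q) < t\<^sup>2 * (q \<bullet> q)"
    using st assms(2) by (intro mult_strict_right_mono power_strict_mono) auto
  ultimately show "norm (x + s *\<^sub>R q) < norm (x + t *\<^sub>R q)"
    unfolding norm_lt e by linarith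
qed

text \<open>
  Completing the square. The constant \<open>xs \<bullet> b\<close> does not involve \<open>y\<close>, so every statement on \<open>qmodel\<close>
  carries over to the error.
\<close>

lemma qform_error_eq_qmodel:
  assumes "transpose A = A" and "A *v xs = b"
  shows "qform A (xs - y) = xs \<bullet> b + 2 * qmodel A b y"
proof -
  have "xs \<bullet> (A *v y) = b \<bullet> y"
    using assms by (metis dot_lmul_matrix transpose_matrix_vector)
  then show ?thesis using assms(2)
    by (simp add: qform_def qmodel_def matrix_vector_mult_diff_distrib inner_diff_left
        inner_diff_right inner_commute)
qed

lemma qmodel_line:
  assumes "transpose A = A"
  shows "qmodel A b (x + \<omega> *\<^sub>R q) =
    qmodel A b x + \<omega> * - (q \<bullet> (b - A *v x)) + \<omega>\<^sup>2 / 2 * (q \<bullet> (A *v q))"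
proof -
  have "x \<bullet> (A *v q) = q \<bullet> (A *v x)"
    using assms by (metis dot_lmul_matrix transpose_matrix_vector inner_commute)
  then show ?thesis
    by (simp add: qmodel_def matrix_vector_right_distrib matrix_vector_mult_scaleR
        inner_add_left inner_add_right inner_diff_right inner_commute power2_eq_square
        field_simps)
qed

section \<open>Monotonicity of MINRES\<close>

text \<open>
  Bootstrapping: nonzero \<open>\<beta>\<^sub>1, \<dots>, \<beta>\<^sub>i\<close> make the Lanczos analysis of the first \<open>i\<close> iterations available, and
  that analysis shows \<open>\<beta>\<^sub>i\<^sub>+\<^sub>1 \<noteq> 0\<close>.
\<close>

lemma beta_next_nz:
  assumes "transpose A = A" and "b \<noteq> 0" and "is_grade A b g" and "i < g"
  shows "st_beta (minres A b i) \<noteq> 0"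
  using assms(4)
proof (induction i rule: less_induct)
  case (less i)
  interpret minres_run A b i
    by unfold_locales (use assms less in auto)
  show ?case
  proof (cases "i = 0")
    case True
    then show ?thesis using assms(2) by (simp add: init)
  next
    case False
    then show ?thesis using beta_next_nz_below_grade[OF assms(3)] less.prems by simp
  qed
qed

theorem theorem5:
  fixes A :: "real^'d^'d" and b :: "real^'d" and g k :: nat
  assumes "transpose A = A"
    and "b \<noteq> 0"
    and "is_grade A b g"
    and "1 \<le> k" and "k < g"
    and "\<forall>i\<in>{1..k}. \<not> npc A b i"
  shows
    "(\<forall>xs. A *v xs = b \<longrightarrow>
        qform A (xs - minres_x A b k) < qform A (xs - minres_x A b (k - 1)))
   \<and> (\<forall>xs. A *v xs = b \<longrightarrow>
        strict_antimono_on {..1}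
          (\<lambda>\<omega>::real. qform A (xs - (minres_x A b (k - 1) + \<omega> *\<^sub>R (minres_tau A b k *\<^sub>R minres_d A b k)))))
   \<and> qmodel A b (minres_x A b k) < qmodel A b (minres_x A b (k - 1))
   \<and> strict_antimono_on {..1}
        (\<lambda>\<omega>::real. qmodel A b (minres_x A b (k - 1) + \<omega> *\<^sub>R (minres_tau A b k *\<^sub>R minres_d A b k)))
   \<and> norm (minres_x A b k) > norm (minres_x A b (k - 1))
   \<and> strict_mono_on {0..}
        (\<lambda>\<omega>::real. norm (minres_x A b (k - 1) + \<omega> *\<^sub>R (minres_tau A b k *\<^sub>R minres_d A b k)))
   \<and> minres_x A b k \<bullet> b > minres_x A b (k - 1) \<bullet> b"
proof -
  interpret minres_run A b g
    by unfold_locales (use assms(1) beta_next_nz[OF assms(1-3)] in auto)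
  from assms(4) obtain i where k: "k = Suc i" by (cases k) auto
  have i: "Suc i < g" "i < g" using k assms(5) by auto
  have npc: "c j * gamma1 (Suc j) < 0" if "j \<le> i" for j
    using assms(6) that k by (auto simp: npc_def not_le dest: bspec[of _ _ "Suc j"])
  define q where "q = minres_tau A b k *\<^sub>R minres_d A b k"
  have q: "q = update (Suc i)" by (simp add: q_def minres_tau_def minres_d_def k)
  define y where "y = minres_x A b (k - 1)"
  have y: "y = x i" by (simp add: y_def minres_x_def k)
  \<comment> \<open>The factor \<open>1\<close> presents \<open>x\<^sub>k\<close> as the point \<open>\<omega> = 1\<close> of the line in the other claims.\<close>
  have step: "minres_x A b k = y + 1 *\<^sub>R q"
    using x_Suc[OF i(1)] by (simp add: minres_x_def k q y)
  have res: "r i = b - A *v y" using residual_eq[OF i(2)] y by simp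
  have curv: "q \<bullet> (A *v q) > 0" unfolding q by (rule update_curvature_pos[OF i(1) npc])
  have "A *v q = r i - r (Suc i)"
    using residual_eq[OF i(1)] x_Suc[OF i(1)] res y q
    by (simp add: matrix_vector_right_distrib)
  \<comment> \<open>The slope of the model at \<open>\<omega> = 1\<close> is \<open>- q \<bullet> r\<^sub>k\<close>.\<close>
  then have slope: "- (q \<bullet> (b - A *v y)) + q \<bullet> (A *v q) \<le> 0"
    using update_inner_residual_pos[OF i(1) npc i(1)] q
    by (simp add: inner_diff_right flip: res)
  have d: "strict_antimono_on {..1} (\<lambda>\<omega>::real. qmodel A b (y + \<omega> *\<^sub>R q))"
    using quadratic_strict_antimono_on[OF qmodel_line[OF assms(1)] curv slope] .
  have c: "qmodel A b (y + 1 *\<^sub>R q) < qmodel A b y"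
    using monotone_onD[OF d, of 0 1] by simp
  have "y \<bullet> q \<ge> 0" unfolding y q by (rule iterate_inner_update_nonneg[OF i(1) npc order_refl])
  moreover have "q \<bullet> q > 0" unfolding q by (rule update_inner_update_pos[OF i(1) npc order_refl])
  ultimately have f: "strict_mono_on {0..} (\<lambda>\<omega>::real. norm (y + \<omega> *\<^sub>R q))"
    by (rule norm_line_strict_mono_on)
  have e: "norm (y + 1 *\<^sub>R q) > norm y"
    using strict_mono_onD[OF f, of 0 1] by simp
  have g: "(y + 1 *\<^sub>R q) \<bullet> b > y \<bullet> b"
    using update_inner_residual_pos[OF i(1) npc, of 0] i q by (simp add: inner_add_left r_0)
  have b: "strict_antimono_on {..1} (\<lambda>\<omega>::real. qform A (xs - (y + \<omega> *\<^sub>R q)))"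
    and a: "qform A (xs - (y + 1 *\<^sub>R q)) < qform A (xs - y)" if "A *v xs = b" for xs
    using d c unfolding qform_error_eq_qmodel[OF assms(1) that] monotone_on_def by simp_all
  show ?thesis
    unfolding step q_def[symmetric] y_def[symmetric] using a b c d e f g by blast
qed

end
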